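(* Let $m, k \in \mathbb{N}^*$, let $a, b \in \mathbb{F}_{2^m}$ with $a \neq 0$, and let $q := 2^k$. Let $\psi := \psi_{a,b,k}$ be the map on $\mathbf{P}^1(\mathbb{F}_{2^m})$ defined by $\psi(x) = \infty$ if $x \in \mathbb{F}_{2^m}$ and $a x^{q} + b = 0$, $\psi(\infty) = 0$, and $\psi(x) = \frac{1}{a x^{q} + b}$ otherwise. Suppose $c, c_1, c_2, c_3 \in \mathbb{F}_{2^m}$ satisfy $$c = c_2^q,\quad c_1 = c_3^q,\quad c_2 c = a + b c_2^q,\quad c_3 = a c_1^q + b c_3^q,$$ and $c_3 + c_1 c_2 \neq 0$ (so that $\psi$ is conjugate, via the map $\tau$ below, to the map $\theta(x) = c x^{q}$, $\theta(\infty) = \infty$, on $\mathbf{P}^1(\mathbb{F}_{2^m})$). Let $d := \gcd(2^k - 1, 2^m - 1)$. Then: (1) the elements $\frac{c_1}{c_3}$ and $\frac{1}{c_2}$ are fixed points of $\psi$; (2) if $(c^{-1})^{\frac{2^m-1}{d}} \neq 1$, then $\psi$ has exactly two fixed points in $\mathbf{P}^1(\mathbb{F}_{2^m})$; (3) if $(c^{-1})^{\frac{2^m-1}{d}} = 1$, then $\psi$ has exactly $d+2$ fixed points in $\mathbf{P}^1(\mathbb{F}_{2^m})$.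
   Context: $\mathbf{P}^1(\mathbb{F}_{2^m}) = \mathbb{F}_{2^m} \cup \{\infty\}$. Under the stated equations one has $c_2 \neq 0$, $c_3 \neq 0$ and $c \neq 0$. The map $\tau$ on $\mathbf{P}^1(\mathbb{F}_{2^m})$ is $\tau(\infty) = 1/c_2$, $\tau(x) = \infty$ if $c_2 x + c_3 = 0$, $\tau(c_1) = 0$, and $\tau(x) = \frac{x + c_1}{c_2 x + c_3}$ otherwise; it satisfies $\psi \circ \tau = \tau \circ \theta$ with $\theta(x) = c x^{2^k}$ for $x \in \mathbb{F}_{2^m}$, $\theta(\infty) = \infty$. *)

theory Defs
  imports "HOL-Library.Cardinality" "HOL-Computational_Algebra.Computational_Algebra" "HOL-Combinatorics.Permutations"
begin

datatype 'a proj_line = Fin 'a | Infty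

fun psi :: "'a::field \<Rightarrow> 'a \<Rightarrow> nat \<Rightarrow> 'a proj_line \<Rightarrow> 'a proj_line" where
  "psi a b k Infty = Fin 0"
| "psi a b k (Fin x) =
     (if a * x ^ (2 ^ k) + b = 0 then Infty else Fin (1 / (a * x ^ (2 ^ k) + b)))"

end

theory Submission
  imports Defs
begin

text \<open>
  The map \<open>\<psi>\<close> is conjugate, via the Moebius transformation
  \<open>\<tau>(x) = (x + c\<^sub>1) / (c\<^sub>2 x + c\<^sub>3)\<close>, to \<open>\<theta>(x) = c x\<^sup>q\<close>. The fixed points of \<open>\<theta>\<close> are
  \<open>\<infinity>\<close>, \<open>0\<close> and the nonzero solutions of \<open>x\<^bsup>q - 1\<^esup> = 1 / c\<close>. These are counted without
  cyclicity of the multiplicative group: put \<open>n = |F| - 1\<close> and \<open>d = gcd (q - 1) n\<close>. Every fibre of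
  \<open>x \<mapsto> x\<^bsup>q - 1\<^esup>\<close> on the units has at most \<open>d\<close> elements, and its image lies in the at most \<open>n / d\<close>
  roots of \<open>y\<^bsup>n / d\<^esup> = 1\<close>; as the fibres partition the \<open>n\<close> units, both bounds are attained.
\<close>

section \<open>Power maps on a finite field\<close>

lemma finite_field_power_card_minus_1:
  fixes x :: "'a::finite_field"
  assumes "x \<noteq> 0"
  shows "x ^ (CARD('a) - 1) = 1"
proof -
  have "x ^ (CARD('a) - 1) * x = x ^ CARD('a)"
    by (simp flip: power_Suc2)
  also have "\<dots> = 1 * x"
    by (simp add: finite_field_power_card_eq_same)
  finally show ?thesis
    using assms by simp
qed

text \<open>Evaluating \<open>x ^ CARD('a) = x\<close> at \<open>-1\<close> with an even exponent
  gives \<open>-1 = 1\<close>.\<close>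

lemma CHAR_eq_2_if_even_card:
  assumes "even CARD('a::finite_field)"
  shows "CHAR('a) = 2"
proof -
  have "(- 1 :: 'a) = (- 1) ^ CARD('a)"
    by (rule finite_field_power_card_eq_same[symmetric])
  also have "\<dots> = 1"
    using assms by simp
  finally have "(1 :: 'a) + 1 = 0"
    by (metis add.right_inverse)
  then have "of_nat 2 = (0 :: 'a)"
    by simp
  then have "CHAR('a) dvd 2"
    by (simp only: of_nat_eq_0_iff_char_dvd)
  then show ?thesis
    by (intro primes_dvd_imp_eq) auto
qed

lemma card_roots_of_unity_le:
  assumes "n > 0"
  shows "card {x::'a::idom. x ^ n = 1} \<le> n"
proof -
  let ?p = "monom 1 n + [:- 1:] :: 'a poly"
  have deg: "degree ?p = n"
    using assms by (subst degree_add_eq_left) (simp_all add: degree_monom_eq)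
  with assms have "?p \<noteq> 0"
    by auto
  from card_poly_roots_bound[OF this] deg show ?thesis
    by (simp add: poly_monom)
qed

text \<open>Dividing by one member of the fibre turns the others into \<open>N\<close>-th roots of
  unity. By Bezout and \<open>y ^ (CARD('a) - 1) = 1\<close>, these are already roots of unity of
  order dividing the gcd.\<close>

lemma card_power_fibre_le:
  fixes e :: "'a::finite_field"
  assumes "N > 0"
  shows "card {x. x \<noteq> 0 \<and> x ^ N = e} \<le> gcd N (CARD('a) - 1)"
proof (cases "\<exists>x. x \<noteq> 0 \<and> x ^ N = e")
  case False
  then have "{x. x \<noteq> 0 \<and> x ^ N = e} = {}"
    by blast
  then show ?thesis
    by (simp only: card.empty le0)
next
  case True
  then obtain x0 where x0: "x0 \<noteq> 0" "x0 ^ N = e"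
    by blast
  let ?n = "CARD('a) - 1" and ?d = "gcd N (CARD('a) - 1)"
  from bezout_nat[of N ?n] assms obtain u v where uv: "N * u = ?n * v + ?d"
    by auto
  have root: "y ^ ?d = 1" if "y \<noteq> 0" "y ^ N = 1" for y :: 'a
  proof -
    have "1 = y ^ (N * u)"
      using that by (simp add: power_mult)
    also have "\<dots> = y ^ ?d"
      using finite_field_power_card_minus_1[OF that(1)]
      by (simp only: uv power_add power_mult power_one mult_1)
    finally show ?thesis ..
  qed
  have "card {x. x \<noteq> 0 \<and> x ^ N = e} \<le> card {y::'a. y ^ ?d = 1}"
  proof (rule card_inj_on_le)
    show "inj_on (\<lambda>x. x / x0) {x. x \<noteq> 0 \<and> x ^ N = e}"
      using x0 by (auto simp: inj_on_def)
    show "(\<lambda>x. x / x0) ` {x. x \<noteq> 0 \<and> x ^ N = e} \<subseteq> {y. y ^ ?d = 1}"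
      using x0 by (auto intro!: root simp only: mem_Collect_eq)
        (auto simp: power_divide)
  qed simp
  also have "\<dots> \<le> ?d"
    using assms by (intro card_roots_of_unity_le) simp
  finally show ?thesis .
qed

theorem card_power_fibre:
  fixes e :: "'a::finite_field"
  assumes "N > 0"
  defines "n \<equiv> CARD('a) - 1"
  defines "d \<equiv> gcd N n"
  shows "card {x. x \<noteq> 0 \<and> x ^ N = e} = (if e ^ (n div d) = 1 then d else 0)"
proof -
  define F where "F y = {x::'a. x \<noteq> 0 \<and> x ^ N = y}" for y
  define H where "H = {y::'a. y ^ (n div d) = 1}"
  have "card {0, 1::'a} \<le> CARD('a)"
    by (intro card_mono) auto
  then have n: "n > 0"
    by (simp add: n_def)
  have d: "d > 0" "d dvd n" "d dvd N"
    using assms by (auto simp: d_def)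
  have nd: "n div d > 0" "n div d * d = n"
    using n d by (auto simp: dvd_div_eq_0_iff)
  have im: "x ^ N \<in> H" if "x \<noteq> 0" for x :: 'a
  proof -
    have "N * (n div d) = n * (N div d)"
      using d by (metis dvd_div_mult mult.commute)
    then have "(x ^ N) ^ (n div d) = (x ^ n) ^ (N div d)"
      by (metis power_mult)
    then show ?thesis
      using finite_field_power_card_minus_1[OF that] by (simp add: H_def n_def)
  qed
  have le: "card (F y) \<le> d" for y
    unfolding F_def d_def n_def using assms(1) by (rule card_power_fibre_le)
  have cardH: "card H \<le> n div d"
    unfolding H_def using nd(1) by (rule card_roots_of_unity_le)
  have "n = card (UNIV - {0::'a})"
    by (simp add: n_def card_Diff_singleton)
  also have "UNIV - {0::'a} = (\<Union>y\<in>H. F y)"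
    using im by (auto simp: F_def)
  also have "card \<dots> = (\<Sum>y\<in>H. card (F y))"
    by (rule card_UN_disjoint) (auto simp: F_def)
  finally have sum: "n = (\<Sum>y\<in>H. card (F y))" .
  have "card (F e) = d" if "e \<in> H"
  proof (rule ccontr)
    assume "card (F e) \<noteq> d"
    with le[of e] have "card (F e) < d"
      by simp
    \<comment> \<open>A single deficient fibre over \<open>H\<close> would push the total strictly
      below \<open>n div d * d = n\<close>.\<close>
    then have "(\<Sum>y\<in>H. card (F y)) < (\<Sum>y\<in>H. d)"
      using le that by (intro sum_strict_mono_ex1) auto
    also have "\<dots> \<le> n div d * d"
      using cardH by simp
    finally show False
      using sum nd by simp
  qed
  moreover have "F e = {}" if "e \<notin> H"
    using that im by (auto simp: F_def)
  ultimately show ?thesis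
    by (auto simp: F_def[symmetric] H_def)
qed

section \<open>Moebius transformations and the conjugation\<close>

fun moebius :: "'a::field \<Rightarrow> 'a \<Rightarrow> 'a \<Rightarrow> 'a \<Rightarrow> 'a proj_line \<Rightarrow> 'a proj_line" where
  "moebius p q r s Infty = (if r = 0 then Infty else Fin (p / r))"
| "moebius p q r s (Fin x) =
     (if r * x + s = 0 then Infty else Fin ((p * x + q) / (r * x + s)))"

text \<open>The inverse is given by the adjugate matrix, whose product with the original is the
  determinant times the identity.\<close>

lemma moebius_inverse:
  assumes "p * s - q * r \<noteq> 0"
  shows "moebius s (- q) (- r) p (moebius p q r s z) = z"
proof (cases z)
  case Infty
  then show ?thesis
    using assms by auto
next
  case (Fin x)
  show ?thesis
  proof (cases "r * x + s = 0")
    \<comment> \<open>At the pole \<open>x = - s / r\<close>, the image is \<open>Infty\<close>,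
      which the adjugate map sends to \<open>s / (- r) = x\<close>.\<close>
    case True
    then have s: "s = - (r * x)"
      by (simp add: eq_neg_iff_add_eq_0 add.commute)
    with assms have "r \<noteq> 0"
      by auto
    with Fin True s show ?thesis
      by simp
  next
    case False
    let ?y = "(p * x + q) / (r * x + s)"
    have den: "- r * ?y + p = (p * s - q * r) / (r * x + s)"
      and num: "s * ?y + - q = (p * s - q * r) * x / (r * x + s)"
      using False by (simp_all add: field_simps)
    show ?thesis
      using Fin False assms by (simp only: moebius.simps if_False den num) simp
  qed
qed

lemma bij_moebius:
  assumes "p * s - q * r \<noteq> 0"
  shows "bij (moebius p q r s)"
proof (rule o_bij)
  show "moebius s (- q) (- r) p \<circ> moebius p q r s = id"
    using moebius_inverse[OF assms] by auto
  \<comment> \<open>The adjugate has the same determinant and its own adjugate is the original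
    matrix, so the same lemma gives the other composition.\<close>
  have "s * p - (- q) * (- r) \<noteq> 0"
    using assms by (simp add: mult.commute)
  from moebius_inverse[OF this] show "moebius p q r s \<circ> moebius s (- q) (- r) p = id"
    by auto
qed

lemma fixpoints_conjugate:
  assumes "bij t" and "\<And>z. f (t z) = t (g z)"
  shows "fixpoints f = t ` fixpoints g"
proof -
  have "f (t z) = t z \<longleftrightarrow> g z = z" for z
    using assms by (metis bij_is_inj injD)
  then show ?thesis
    using bij_is_surj[OF assms(1)] by (auto simp: image_iff) (metis surjD)
qed

fun theta :: "'a::field \<Rightarrow> nat \<Rightarrow> 'a proj_line \<Rightarrow> 'a proj_line" where
  "theta c k Infty = Infty"
| "theta c k (Fin x) = Fin (c * x ^ (2 ^ k))"

lemma fixpoints_theta: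
  assumes "c \<noteq> 0"
  shows "fixpoints (theta c k) =
    {Infty, Fin 0} \<union> Fin ` {x. x \<noteq> 0 \<and> x ^ (2 ^ k - 1) = inverse c}"
proof -
  have "c * x ^ (2 ^ k) = x \<longleftrightarrow> x ^ (2 ^ k - 1) = inverse c" if "x \<noteq> 0" for x
  proof -
    have "x ^ (2 ^ k) = x ^ (2 ^ k - 1) * x"
      by (simp flip: power_Suc2)
    then show ?thesis
      using assms that by (auto simp: field_simps)
  qed
  then have "theta c k z = z \<longleftrightarrow>
      z \<in> {Infty, Fin 0} \<union> Fin ` {x. x \<noteq> 0 \<and> x ^ (2 ^ k - 1) = inverse c}" for z
    by (cases z) auto
  then show ?thesis
    by blast
qed

text \<open>Since \<open>x ^ (2 ^ k)\<close> is additive, both sides are a matrix applied to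
  \<open>x ^ (2 ^ k)\<close>. The four equations say that the product of the rows
  \<open>(0, 1)\<close>, \<open>(a, b)\<close> with the entrywise \<open>2 ^ k\<close>-th power of
  the matrix of \<open>moebius\<close> equals that matrix times \<open>diag(c, 1)\<close>.\<close>

lemma psi_moebius_conjugate:
  fixes a b c c\<^sub>1 c\<^sub>2 c\<^sub>3 :: "'a::field"
  assumes char: "CHAR('a) = 2"
    and "c\<^sub>2 \<noteq> 0"
    and c: "c = c\<^sub>2 ^ (2 ^ k)" and c1: "c\<^sub>1 = c\<^sub>3 ^ (2 ^ k)"
    and c2: "c\<^sub>2 * c = a + b * c\<^sub>2 ^ (2 ^ k)"
    and c3: "c\<^sub>3 = a * c\<^sub>1 ^ (2 ^ k) + b * c\<^sub>3 ^ (2 ^ k)"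
    and det: "c\<^sub>3 + c\<^sub>1 * c\<^sub>2 \<noteq> 0"
  shows "psi a b k (moebius 1 c\<^sub>1 c\<^sub>2 c\<^sub>3 z) = moebius 1 c\<^sub>1 c\<^sub>2 c\<^sub>3 (theta c k z)"
proof -
  have frob: "(x + y) ^ (2 ^ k) = x ^ (2 ^ k) + y ^ (2 ^ k)" for x y :: 'a
    by (rule freshmans_dream') (simp_all add: char)
  have "c \<noteq> 0"
    using c \<open>c\<^sub>2 \<noteq> 0\<close> by simp
  show ?thesis
  proof (cases z)
    case Infty
    \<comment> \<open>This is \<open>c2\<close> divided by \<open>c = c\<^sub>2 ^ (2 ^ k)\<close>;
      it makes \<open>1 / c\<^sub>2\<close>, the image of \<open>Infty\<close>, fixed by
      \<open>psi\<close>.\<close>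
    have "a * (1 / c\<^sub>2) ^ (2 ^ k) + b = c\<^sub>2"
      using c2 \<open>c \<noteq> 0\<close> by (simp add: power_divide flip: c) (simp add: field_simps)
    then show ?thesis
      using Infty \<open>c\<^sub>2 \<noteq> 0\<close> by simp
  next
    case (Fin x)
    let ?X = "x ^ (2 ^ k)"
    have den: "(c\<^sub>2 * x + c\<^sub>3) ^ (2 ^ k) = c * ?X + c\<^sub>1"
      by (simp add: frob power_mult_distrib c c1)
    have num: "a * (x + c\<^sub>1) ^ (2 ^ k) + b * (c\<^sub>2 * x + c\<^sub>3) ^ (2 ^ k) = c\<^sub>2 * (c * ?X) + c\<^sub>3"
    proof -
      have "a * (x + c\<^sub>1) ^ (2 ^ k) + b * (c\<^sub>2 * x + c\<^sub>3) ^ (2 ^ k)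
          = (a + b * c\<^sub>2 ^ (2 ^ k)) * ?X + (a * c\<^sub>1 ^ (2 ^ k) + b * c\<^sub>3 ^ (2 ^ k))"
        by (simp only: frob power_mult_distrib) (simp add: algebra_simps)
      also have "\<dots> = c\<^sub>2 * (c * ?X) + c\<^sub>3"
        by (simp only: c2[symmetric] c3[symmetric] mult.assoc)
      finally show ?thesis .
    qed
    show ?thesis
    proof (cases "c\<^sub>2 * x + c\<^sub>3 = 0")
      case True
      then have X: "c * ?X + c\<^sub>1 = 0"
        using den by (simp add: power_0_left)
      \<comment> \<open>The left side is \<open>psi\<close> at \<open>Infty\<close>, that is
        \<open>Fin 0\<close>. On the right the numerator vanishes, so it remains to exclude a
        vanishing denominator, which would make the determinant zero.\<close>
      have "c\<^sub>2 * (c * ?X) + c\<^sub>3 \<noteq> 0"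
      proof
        assume "c\<^sub>2 * (c * ?X) + c\<^sub>3 = 0"
        moreover have "c * ?X = c\<^sub>1"
          using X char by (metis add_eq_0_iff uminus_CHAR_2)
        ultimately show False
          using det by (simp add: algebra_simps)
      qed
      then show ?thesis
        using Fin True X by simp
    next
      case False
      let ?D = "c * ?X + c\<^sub>1" and ?N = "c\<^sub>2 * (c * ?X) + c\<^sub>3"
      have "?D \<noteq> 0"
        using False den by (metis power_not_zero)
      \<comment> \<open>Both sides of the goal are thus \<open>Infty\<close> if
        \<open>?N = 0\<close> and \<open>Fin (?D / ?N)\<close> otherwise.\<close>
      then have "a * ((x + c\<^sub>1) / (c\<^sub>2 * x + c\<^sub>3)) ^ (2 ^ k) + b = ?N / ?D"
        using num by (simp add: power_divide den) (simp add: field_simps)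
      then show ?thesis
        using Fin False \<open>?D \<noteq> 0\<close> by simp
    qed
  qed
qed

theorem theorem5p1:
  fixes m k q d :: nat
    and a b c c\<^sub>1 c\<^sub>2 c\<^sub>3 :: "'a::finite_field"
    and \<psi> :: "'a proj_line \<Rightarrow> 'a proj_line"
  assumes "m \<ge> 1" and "k \<ge> 1"
    and "CARD('a) = 2 ^ m"
    and "a \<noteq> 0"
    and "q = 2 ^ k"
    and "\<psi> = psi a b k"
    and "c = c\<^sub>2 ^ q"
    and "c\<^sub>1 = c\<^sub>3 ^ q"
    and "c\<^sub>2 * c = a + b * c\<^sub>2 ^ q"
    and "c\<^sub>3 = a * c\<^sub>1 ^ q + b * c\<^sub>3 ^ q"
    and "c\<^sub>3 + c\<^sub>1 * c\<^sub>2 \<noteq> 0"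
    and "d = gcd (2 ^ k - 1) (2 ^ m - 1)"
  shows "(Fin (c\<^sub>1 / c\<^sub>3) \<in> fixpoints \<psi> \<and> Fin (1 / c\<^sub>2) \<in> fixpoints \<psi>) \<and>
    (inverse c ^ ((2 ^ m - 1) div d) \<noteq> 1 \<longrightarrow> card (fixpoints \<psi>) = 2) \<and>
    (inverse c ^ ((2 ^ m - 1) div d) = 1 \<longrightarrow> card (fixpoints \<psi>) = d + 2)"
proof -
  have char: "CHAR('a) = 2"
    using assms(1,3) by (intro CHAR_eq_2_if_even_card) simp
  have "q > 0"
    by (simp add: assms(5))
  \<comment> \<open>If \<open>c\<^sub>2\<close> were zero, so would be \<open>c\<close>, and the
    equation for \<open>c\<^sub>2 * c\<close> would force \<open>a = 0\<close>.\<close>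
  have "c\<^sub>2 \<noteq> 0"
    using assms(4,7,9) \<open>q > 0\<close> by (auto simp: power_0_left)
  then have "c \<noteq> 0"
    by (simp add: assms(7))
  \<comment> \<open>If \<open>c\<^sub>3\<close> were zero, so would be \<open>c\<^sub>1\<close>, and
    the determinant would vanish.\<close>
  have "c\<^sub>3 \<noteq> 0"
    using assms(8,11) \<open>q > 0\<close> by (auto simp: power_0_left)
  let ?\<tau> = "moebius 1 c\<^sub>1 c\<^sub>2 c\<^sub>3" and ?S = "{x. x \<noteq> 0 \<and> x ^ (2 ^ k - 1) = inverse c}"
  have "1 * c\<^sub>3 - c\<^sub>1 * c\<^sub>2 \<noteq> 0"
    using assms(11) by (simp add: minus_CHAR_2[OF char])
  then have bij: "bij ?\<tau>"
    by (rule bij_moebius)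
  have fix_\<psi>: "fixpoints \<psi> = ?\<tau> ` fixpoints (theta c k)"
    unfolding assms(6) using bij
  proof (rule fixpoints_conjugate)
    show "psi a b k (?\<tau> z) = ?\<tau> (theta c k z)" for z
      using char \<open>c\<^sub>2 \<noteq> 0\<close> assms(7-11) unfolding assms(5) by (rule psi_moebius_conjugate)
  qed
  have fix_\<theta>: "fixpoints (theta c k) = {Infty, Fin 0} \<union> Fin ` ?S"
    using \<open>c \<noteq> 0\<close> by (rule fixpoints_theta)
  \<comment> \<open>The two named fixed points are the images of the fixed points \<open>0\<close>
    and \<open>Infty\<close> of \<open>theta\<close>.\<close>
  have "?\<tau> (Fin 0) \<in> fixpoints \<psi>" "?\<tau> Infty \<in> fixpoints \<psi>"
    unfolding fix_\<psi> fix_\<theta> by blast+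
  then have points: "Fin (c\<^sub>1 / c\<^sub>3) \<in> fixpoints \<psi>" "Fin (1 / c\<^sub>2) \<in> fixpoints \<psi>"
    using \<open>c\<^sub>2 \<noteq> 0\<close> \<open>c\<^sub>3 \<noteq> 0\<close> by simp_all
  have "card (fixpoints \<psi>) = card ({Infty, Fin 0} \<union> Fin ` ?S)"
    unfolding fix_\<psi> fix_\<theta>
    by (rule card_image[OF inj_on_subset[OF bij_is_inj[OF bij] subset_UNIV]])
  also have "\<dots> = 2 + card (Fin ` ?S)"
    by (subst card_Un_disjoint) auto
  also have "card (Fin ` ?S) = card ?S"
    by (intro card_image) (simp add: inj_on_def)
  also have "card ?S = (if inverse c ^ ((2 ^ m - 1) div d) = 1 then d else 0)"
  proof -
    \<comment> \<open>From \<open>k \<ge> 1\<close> comes the positive exponent that the fibre count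
      requires.\<close>
    have "(2::nat) ^ 1 \<le> 2 ^ k"
      using assms(2) by (intro power_increasing) auto
    then have "(2::nat) ^ k - 1 > 0"
      by simp
    from card_power_fibre[OF this, of "inverse c"] show ?thesis
      by (simp add: assms(3,12))
  qed
  finally show ?thesis
    using points by simp
qed

end
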